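(* Let $H$ be a Hilbert space, let $\mathcal A=B(H)$ be the algebra of all bounded linear operators on $H$, and let $T:l^2(\mathcal A)\to l^2(\mathcal A)$ be a compact operator, i.e. $T\in B^a(l^2(\mathcal A))$ and $T$ maps every norm bounded subset of $l^2(\mathcal A)$ to a set that is totally bounded in the topology $\tau$. Then $T$ is "compact", i.e. $T$ belongs to the operator-norm closure of the linear span of the operators $\Theta_{y,z}:x\mapsto z\langle y,x\rangle$, $y,z\in l^2(\mathcal A)$.
   Context: For a unital $W^*$-algebra $\mathcal A$, the standard Hilbert module is the right $\mathcal A$-module $l^2(\mathcal A)$ of all sequences $x=(\xi_1,\xi_2,\dots)$ in $\mathcal A$ such that $\sum_{j=1}^{\infty}\xi_j^*\xi_j$ converges in norm, with coordinatewise operations, inner product $\langle x,y\rangle=\sum_{j=1}^{\infty}\xi_j^*\eta_j$ (for $y=(\eta_1,\eta_2,\dots)$) and norm $\|x\|=\|\langle x,x\rangle\|^{1/2}$. $B^a(l^2(\mathcal A))$ denotes the algebra of all bounded $\mathcal A$-linear operators on $l^2(\mathcal A)$ having an adjoint with respect to $\langle\cdot,\cdot\rangle$. The topology $\tau$ on $l^2(\mathcal A)$ is the locally convex topology generated by all seminorms $p_{\varphi,y}(x)=\sqrt{\sum_{j=1}^{\infty}|\varphi(\eta_j^*\xi_j)|^2}$, $x=(\xi_1,\xi_2,\dots)$, where $\varphi$ is a normal state on $\mathcal A$ and $y=(\eta_1,\eta_2,\dots)$ is any sequence in $\mathcal A$ with $\sup_{j\ge1}\varphi(\eta_j^*\eta_j)=1$.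 A set $S\subseteq l^2(\mathcal A)$ is totally bounded in $\tau$ if for every such seminorm $p=p_{\varphi,y}$ and every $\varepsilon>0$ there are finitely many points $c_1,\dots,c_m\in l^2(\mathcal A)$ such that the sets $\{x : p(c_i-x)<\varepsilon\}$ cover $S$. *)

theory Defs
  imports "HOL-Analysis.Analysis"
begin

text \<open>Complex Hilbert spaces of arbitrary dimension, the zero space included. As everywhere below,
  inner products are linear in the second argument.\<close>

class chilbert_space = banach +
  fixes scaleC :: "complex \<Rightarrow> 'a \<Rightarrow> 'a"  (infixr "*\<^sub>C" 75)
    and cinner :: "'a \<Rightarrow> 'a \<Rightarrow> complex"
  assumes scaleC_add_right: "c *\<^sub>C (x + y) = c *\<^sub>C x + c *\<^sub>C y"
    and scaleC_add_left: "(c + d) *\<^sub>C x = c *\<^sub>C x + d *\<^sub>C x"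
    and scaleC_scaleC: "c *\<^sub>C d *\<^sub>C x = (c * d) *\<^sub>C x"
    and scaleR_scaleC: "r *\<^sub>R x = complex_of_real r *\<^sub>C x"
    and cinner_commute: "cinner x y = cnj (cinner y x)"
    and cinner_add_right: "cinner x (y + z) = cinner x y + cinner x z"
    and cinner_scaleC_right: "cinner x (c *\<^sub>C y) = c * cinner x y"
    and cinner_self: "cinner x x = complex_of_real ((norm x)\<^sup>2)"

instantiation complex :: chilbert_space
begin

definition scaleC_complex :: "complex \<Rightarrow> complex \<Rightarrow> complex"
  where "scaleC_complex c x = c * x"

definition cinner_complex :: "complex \<Rightarrow> complex \<Rightarrow> complex"
  where "cinner_complex x y = cnj x * y"

instance
proof
  show "cinner x x = complex_of_real ((norm x)\<^sup>2)" for x :: complex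
    by (metis cinner_complex_def complex_norm_square mult.commute)
qed (simp_all add: scaleC_complex_def cinner_complex_def algebra_simps scaleR_conv_of_real)

end


section \<open>The algebra of bounded operators\<close>

text \<open>The elements of the type of bounded linear maps are only real-linear; \<open>BH\<close> cuts out the
  complex-linear ones. Its norm is the operator norm, its product is \<open>o\<^sub>L\<close>.\<close>

definition BH :: "('h::chilbert_space \<Rightarrow>\<^sub>L 'h) set"
  where "BH = {a. \<forall>c v. blinfun_apply a (c *\<^sub>C v) = c *\<^sub>C blinfun_apply a v}"

definition adj :: "('h::chilbert_space \<Rightarrow>\<^sub>L 'h) \<Rightarrow> ('h \<Rightarrow>\<^sub>L 'h)"
  where "adj a = (THE b. b \<in> BH \<and>
    (\<forall>v w. cinner (blinfun_apply a v) w = cinner v (blinfun_apply b w)))"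

definition op_scaleC :: "complex \<Rightarrow> ('h::chilbert_space \<Rightarrow>\<^sub>L 'h) \<Rightarrow> ('h \<Rightarrow>\<^sub>L 'h)"
  where "op_scaleC c a = Blinfun (\<lambda>v. c *\<^sub>C blinfun_apply a v)"

definition op_pos :: "('h::chilbert_space \<Rightarrow>\<^sub>L 'h) \<Rightarrow> bool"
  where "op_pos a \<longleftrightarrow> a \<in> BH \<and>
    (\<forall>v. Im (cinner v (blinfun_apply a v)) = 0 \<and> 0 \<le> Re (cinner v (blinfun_apply a v)))"

definition op_le :: "('h::chilbert_space \<Rightarrow>\<^sub>L 'h) \<Rightarrow> ('h \<Rightarrow>\<^sub>L 'h) \<Rightarrow> bool"
  where "op_le a b \<longleftrightarrow> op_pos (b - a)"

definition BH_sa :: "('h::chilbert_space \<Rightarrow>\<^sub>L 'h) set"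
  where "BH_sa = {a \<in> BH. adj a = a}"

lemma norm_scaleC: "norm (c *\<^sub>C v) = cmod c * norm (v::'h::chilbert_space)"
proof -
  have "cinner (c *\<^sub>C v) (c *\<^sub>C v) = c * cnj (c * cinner v v)"
    by (metis cinner_scaleC_right cinner_commute)
  then have "complex_of_real ((norm (c *\<^sub>C v))\<^sup>2) = complex_of_real ((cmod c * norm v)\<^sup>2)"
    by (simp add: cinner_self complex_norm_square[symmetric] power_mult_distrib
        mult.assoc[symmetric])
  then have "(norm (c *\<^sub>C v))\<^sup>2 = (cmod c * norm v)\<^sup>2"
    using of_real_eq_iff by blast
  then show ?thesis
    by (simp add: power2_eq_iff_nonneg)
qed

lemma op_scaleC_apply [simp]: "blinfun_apply (op_scaleC c a) v = c *\<^sub>C blinfun_apply a v"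
proof -
  have "bounded_linear (\<lambda>v::'a. c *\<^sub>C v)"
    by (rule bounded_linear_intro[where K = "cmod c"])
       (simp_all add: scaleC_add_right scaleR_scaleC scaleC_scaleC norm_scaleC mult.commute)
  then have "bounded_linear (\<lambda>v. c *\<^sub>C blinfun_apply a v)"
    by (rule bounded_linear_compose) (rule blinfun.bounded_linear_right)
  then show ?thesis
    by (simp add: op_scaleC_def bounded_linear_Blinfun_apply)
qed


section \<open>Normal states\<close>

definition is_state :: "(('h::chilbert_space \<Rightarrow>\<^sub>L 'h) \<Rightarrow> complex) \<Rightarrow> bool"
  where "is_state \<phi> \<longleftrightarrow>
    (\<forall>a\<in>BH. \<forall>b\<in>BH. \<phi> (a + b) = \<phi> a + \<phi> b) \<and>
    (\<forall>c. \<forall>a\<in>BH. \<phi> (op_scaleC c a) = c * \<phi> a) \<and>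
    (\<forall>a. op_pos a \<longrightarrow> Im (\<phi> a) = 0 \<and> 0 \<le> Re (\<phi> a)) \<and>
    \<phi> id_blinfun = 1"

definition op_directed :: "('h::chilbert_space \<Rightarrow>\<^sub>L 'h) set \<Rightarrow> bool"
  where "op_directed D \<longleftrightarrow> D \<noteq> {} \<and> (\<forall>a\<in>D. \<forall>b\<in>D. \<exists>c\<in>D. op_le a c \<and> op_le b c)"

definition op_is_lub :: "('h::chilbert_space \<Rightarrow>\<^sub>L 'h) set \<Rightarrow> ('h \<Rightarrow>\<^sub>L 'h) \<Rightarrow> bool"
  where "op_is_lub D s \<longleftrightarrow> s \<in> BH_sa \<and> (\<forall>a\<in>D. op_le a s) \<and>
    (\<forall>b\<in>BH_sa. (\<forall>a\<in>D. op_le a b) \<longrightarrow> op_le s b)"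

text \<open>A state is normal if it preserves suprema of bounded increasing nets of self-adjoint
  elements; nets are rendered as upward directed sets.\<close>

definition normal_state :: "(('h::chilbert_space \<Rightarrow>\<^sub>L 'h) \<Rightarrow> complex) \<Rightarrow> bool"
  where "normal_state \<phi> \<longleftrightarrow> is_state \<phi> \<and>
    (\<forall>D s. D \<subseteq> BH_sa \<and> op_directed D \<and> op_is_lub D s \<longrightarrow>
      Re (\<phi> s) = (SUP a\<in>D. Re (\<phi> a)))"


section \<open>The standard Hilbert module\<close>

definition l2A :: "(nat \<Rightarrow> 'h::chilbert_space \<Rightarrow>\<^sub>L 'h) set"
  where "l2A = {x. (\<forall>j. x j \<in> BH) \<and> summable (\<lambda>j. adj (x j) o\<^sub>L x j)}"

definition hinner :: "(nat \<Rightarrow> 'h::chilbert_space \<Rightarrow>\<^sub>L 'h) \<Rightarrow> (nat \<Rightarrow> 'h \<Rightarrow>\<^sub>L 'h) \<Rightarrow> ('h \<Rightarrow>\<^sub>L 'h)"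
  where "hinner x y = (\<Sum>j. adj (x j) o\<^sub>L y j)"

definition hnorm :: "(nat \<Rightarrow> 'h::chilbert_space \<Rightarrow>\<^sub>L 'h) \<Rightarrow> real"
  where "hnorm x = sqrt (norm (hinner x x))"

definition hbounded :: "(nat \<Rightarrow> 'h::chilbert_space \<Rightarrow>\<^sub>L 'h) set \<Rightarrow> bool"
  where "hbounded S \<longleftrightarrow> S \<subseteq> l2A \<and> (\<exists>K. \<forall>x\<in>S. hnorm x \<le> K)"


section \<open>Operators on the standard Hilbert module\<close>

text \<open>Operators are functions on all sequences of which only the values on \<open>l2A\<close> matter.
  Complex homogeneity is the case \<open>a = op_scaleC c id_blinfun\<close> of \<open>BH\<close>-linearity.\<close>

type_synonym 'h l2_op = "(nat \<Rightarrow> 'h \<Rightarrow>\<^sub>L 'h) \<Rightarrow> (nat \<Rightarrow> 'h \<Rightarrow>\<^sub>L 'h)"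

definition A_linear :: "'h::chilbert_space l2_op \<Rightarrow> bool"
  where "A_linear T \<longleftrightarrow> (\<forall>x\<in>l2A. T x \<in> l2A) \<and>
    (\<forall>x\<in>l2A. \<forall>y\<in>l2A. T (\<lambda>j. x j + y j) = (\<lambda>j. T x j + T y j)) \<and>
    (\<forall>x\<in>l2A. \<forall>a\<in>BH. T (\<lambda>j. x j o\<^sub>L a) = (\<lambda>j. T x j o\<^sub>L a))"

definition Ba :: "'h::chilbert_space l2_op set"
  where "Ba = {T. A_linear T \<and>
    (\<exists>K. \<forall>x\<in>l2A. hnorm (T x) \<le> K * hnorm x) \<and>
    (\<exists>S. (\<forall>y\<in>l2A. S y \<in> l2A) \<and> (\<forall>x\<in>l2A. \<forall>y\<in>l2A. hinner (T x) y = hinner x (S y)))}"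

definition opnorm :: "'h::chilbert_space l2_op \<Rightarrow> real"
  where "opnorm T = (SUP x\<in>{x \<in> l2A. hnorm x \<le> 1}. hnorm (T x))"

definition Theta :: "(nat \<Rightarrow> 'h::chilbert_space \<Rightarrow>\<^sub>L 'h) \<Rightarrow> (nat \<Rightarrow> 'h \<Rightarrow>\<^sub>L 'h) \<Rightarrow> 'h l2_op"
  where "Theta y z = (\<lambda>x j. z j o\<^sub>L hinner y x)"

definition Theta_span :: "'h::chilbert_space l2_op set"
  where "Theta_span = {F. \<exists>(n::nat) c Y Z. (\<forall>i<n. Y i \<in> l2A \<and> Z i \<in> l2A) \<and>
    F = (\<lambda>x j. \<Sum>i<n. op_scaleC (c i) (Theta (Y i) (Z i) x j))}"

definition opnorm_closure :: "'h::chilbert_space l2_op set \<Rightarrow> 'h l2_op set"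
  where "opnorm_closure \<F> =
    {T \<in> Ba. \<forall>\<epsilon>>0. \<exists>F\<in>\<F>. opnorm (\<lambda>x j. T x j - F x j) < \<epsilon>}"


section \<open>The topology tau and compact operators\<close>

text \<open>The supremum of an unbounded set of reals is unspecified, hence the explicit boundedness.\<close>

definition tau_admissible ::
    "(('h::chilbert_space \<Rightarrow>\<^sub>L 'h) \<Rightarrow> complex) \<Rightarrow> (nat \<Rightarrow> 'h \<Rightarrow>\<^sub>L 'h) \<Rightarrow> bool"
  where "tau_admissible \<phi> y \<longleftrightarrow> normal_state \<phi> \<and> (\<forall>j. y j \<in> BH) \<and>
    bdd_above (range (\<lambda>j. Re (\<phi> (adj (y j) o\<^sub>L y j)))) \<and>
    (SUP j. Re (\<phi> (adj (y j) o\<^sub>L y j))) = 1"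

definition tau_seminorm ::
    "(('h::chilbert_space \<Rightarrow>\<^sub>L 'h) \<Rightarrow> complex) \<Rightarrow> (nat \<Rightarrow> 'h \<Rightarrow>\<^sub>L 'h) \<Rightarrow> (nat \<Rightarrow> 'h \<Rightarrow>\<^sub>L 'h) \<Rightarrow> real"
  where "tau_seminorm \<phi> y x = sqrt (\<Sum>j. (cmod (\<phi> (adj (y j) o\<^sub>L x j)))\<^sup>2)"

definition tau_totally_bounded :: "(nat \<Rightarrow> 'h::chilbert_space \<Rightarrow>\<^sub>L 'h) set \<Rightarrow> bool"
  where "tau_totally_bounded S \<longleftrightarrow>
    (\<forall>\<phi> y \<epsilon>. tau_admissible \<phi> y \<and> 0 < \<epsilon> \<longrightarrow>
      (\<exists>C. finite C \<and> C \<subseteq> l2A \<and>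
        (\<forall>x\<in>S. \<exists>c\<in>C. tau_seminorm \<phi> y (\<lambda>j. c j - x j) < \<epsilon>)))"

definition compact_op :: "'h::chilbert_space l2_op \<Rightarrow> bool"
  where "compact_op T \<longleftrightarrow> T \<in> Ba \<and> (\<forall>S. hbounded S \<longrightarrow> tau_totally_bounded (T ` S))"

end

theory Submission
  imports Defs
begin

text \<open>Let \<open>P\<^sub>n\<close> be the projection onto the first \<open>n\<close> coordinates. If \<open>S\<close> is the adjoint of \<open>T\<close> and \<open>e\<^sub>i\<close>
  the \<open>i\<close>-th unit sequence, then \<open>P\<^sub>n T\<close> is the sum of the \<open>\<Theta>\<close>-operators of the pairs \<open>(S e\<^sub>i, e\<^sub>i)\<close>,
  \<open>i < n\<close>, so it suffices that \<open>P\<^sub>n T\<close> tends to \<open>T\<close> in norm. Otherwise there are \<open>d > 0\<close>, points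
  \<open>x\<^sub>k\<close> of the unit ball, consecutive blocks of indices and unit vectors \<open>v\<^sub>k\<close> of \<open>H\<close> such that
  the sum of \<open>\<parallel>(T x\<^sub>k)\<^sub>j v\<^sub>k\<parallel>\<^sup>2\<close> over the \<open>k\<close>-th block exceeds \<open>d\<^sup>2\<close>. Multiplying \<open>x\<^sub>k\<close> from the right by
  the rank one operator mapping a fixed unit vector \<open>\<xi>\<close> to \<open>v\<^sub>k\<close> makes all \<open>v\<^sub>k\<close> equal to \<open>\<xi>\<close>. Take the
  vector state of \<open>\<xi>\<close> and let \<open>y\<^sub>j\<close> be the rank one operator mapping \<open>\<xi>\<close> to the direction of
  \<open>(T x\<^sub>k)\<^sub>j \<xi>\<close>, \<open>j\<close> in the \<open>k\<close>-th block. In the resulting seminorm the \<open>k\<close>-th block of \<open>T x\<^sub>k\<close>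
  exceeds \<open>d\<close>, whereas the blocks of finitely many centres tend to \<open>0\<close>: the image
  of the unit ball is not totally bounded.\<close>

section \<open>Hilbert spaces\<close>

lemma cinner_add_left: "cinner (x + y) z = cinner x z + cinner y (z::'h::chilbert_space)"
  by (metis cinner_add_right cinner_commute complex_cnj_add)

lemma cinner_scaleC_left: "cinner (c *\<^sub>C x) y = cnj c * cinner x (y::'h::chilbert_space)"
  by (metis cinner_scaleC_right cinner_commute complex_cnj_mult)

lemma Re_cinner_self: "Re (cinner x x) = (norm (x::'h::chilbert_space))\<^sup>2"
  by (simp add: cinner_self)

lemma scaleC_one: "1 *\<^sub>C x = (x::'h::chilbert_space)"
  by (metis of_real_1 scaleR_one scaleR_scaleC)

text \<open>Semidefinite forms are allowed because the inequality is applied to the inner product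
  and also to the form of a positive operator \<open>c - a0\<close>.\<close>

lemma form_Cauchy_Schwarz:
  fixes f :: "'h::chilbert_space \<Rightarrow> 'h \<Rightarrow> complex"
  assumes add: "\<And>x y z. f x (y + z) = f x y + f x z"
    and scale: "\<And>c x y. f x (c *\<^sub>C y) = c * f x y"
    and herm: "\<And>x y. f y x = cnj (f x y)"
    and pos: "\<And>x. 0 \<le> Re (f x x)"
  shows "(cmod (f v w))\<^sup>2 \<le> Re (f v v) * Re (f w w)"
proof -
  define z where "z = f v w"
  have addl: "f (x + y) u = f x u + f y u" for x y u
    by (metis add herm complex_cnj_add)
  have scalel: "f (c *\<^sub>C x) y = cnj c * f x y" for c x y
    by (metis scale herm complex_cnj_mult)
  have sa: "f x x = complex_of_real (Re (f x x))" for x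
    using herm[of x x] by (simp add: complex_eq_iff)
  have key: "0 \<le> Re (f v v) + 2 * t * (cmod z)\<^sup>2 + t\<^sup>2 * (cmod z)\<^sup>2 * Re (f w w)" for t :: real
  proof -
    \<comment> \<open>The factor \<open>cnj z\<close> turns both cross terms into the real number
      \<open>t * |z|^2\<close>.\<close>
    define c where "c = complex_of_real t * cnj z"
    have "f (v + c *\<^sub>C w) (v + c *\<^sub>C w)
        = f v v + c * z + cnj c * cnj z + cnj c * c * f w w"
      by (simp add: add addl scale scalel z_def herm[of v w] algebra_simps)
    also have "c * z = of_real (t * (cmod z)\<^sup>2)"
      unfolding c_def using complex_norm_square[of z] by (simp add: mult_ac)
    also have "cnj c * cnj z = of_real (t * (cmod z)\<^sup>2)"
      unfolding c_def using complex_norm_square[of z] by (simp add: mult_ac)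
    also have "cnj c * c = of_real (t\<^sup>2 * (cmod z)\<^sup>2)"
      unfolding c_def using complex_norm_square[of z] by (simp add: mult_ac power2_eq_square)
    finally have "Re (f (v + c *\<^sub>C w) (v + c *\<^sub>C w)) =
        Re (f v v) + 2 * t * (cmod z)\<^sup>2 + t\<^sup>2 * (cmod z)\<^sup>2 * Re (f w w)"
      by (simp add: Re_complex_of_real)
    then show ?thesis
      using pos[of "v + c *\<^sub>C w"] by simp
  qed
  show ?thesis
  proof (cases "Re (f w w) = 0")
    case True
    \<comment> \<open>Without its quadratic term the bound \<open>key\<close> is affine in
      \<open>t\<close>; the \<open>t\<close> chosen below would give it the value -1.\<close>
    have "z = 0"
    proof (rule ccontr)
      assume "z \<noteq> 0"
      then have "(cmod z)\<^sup>2 > 0" by simp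
      with key[of "- (Re (f v v) + 1) / (2 * (cmod z)\<^sup>2)"] True show False
        by (simp add: field_simps)
    qed
    then show ?thesis
      using True by (simp add: z_def)
  next
    case False
    then have p: "Re (f w w) > 0" using pos[of w] by simp
    \<comment> \<open>This \<open>t\<close> minimises the quadratic.\<close>
    from key[of "- 1 / Re (f w w)"] p show ?thesis
      by (simp add: field_simps power2_eq_square z_def)
  qed
qed

lemma cinner_Cauchy_Schwarz: "cmod (cinner v w) \<le> norm v * norm (w::'h::chilbert_space)"
proof -
  have "(cmod (cinner v w))\<^sup>2 \<le> Re (cinner v v) * Re (cinner w w)"
    by (rule form_Cauchy_Schwarz)
      (auto simp: cinner_add_right cinner_scaleC_right Re_cinner_self intro: cinner_commute)
  then have "(cmod (cinner v w))\<^sup>2 \<le> (norm v * norm w)\<^sup>2"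
    by (simp add: Re_cinner_self power_mult_distrib)
  then show ?thesis
    by (rule power2_le_imp_le) simp
qed

lemma bounded_bilinear_cinner:
  "bounded_bilinear (cinner :: 'h::chilbert_space \<Rightarrow> 'h \<Rightarrow> complex)"
proof
  show "\<exists>K. \<forall>a b::'h. norm (cinner a b) \<le> norm a * norm b * K"
    by (rule exI[of _ 1]) (simp add: cinner_Cauchy_Schwarz)
qed (simp_all add: cinner_add_left cinner_add_right scaleR_scaleC cinner_scaleC_left
    cinner_scaleC_right scaleC_complex_def)

interpretation cinner: bounded_bilinear "cinner :: 'h::chilbert_space \<Rightarrow> 'h \<Rightarrow> complex"
  by (rule bounded_bilinear_cinner)

lemma cinner_eqI: "(\<And>w. cinner w x = cinner w y) \<Longrightarrow> x = (y::'h::chilbert_space)"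
proof -
  assume "\<And>w. cinner w x = cinner w y"
  then have "cinner (x - y) (x - y) = 0"
    by (simp add: cinner.diff_right)
  then show ?thesis by (simp add: cinner_self)
qed

lemma norm_add_square:
  "(norm (x + y))\<^sup>2 = (norm x)\<^sup>2 + 2 * Re (cinner x y) + (norm (y::'h::chilbert_space))\<^sup>2"
proof -
  have "Re (cinner y x) = Re (cinner x y)"
    by (subst cinner_commute) simp
  then show ?thesis
    unfolding Re_cinner_self[symmetric] by (simp add: cinner.add_left cinner.add_right)
qed

text \<open>The representing vector minimises \<open>\<parallel>v\<parallel>\<^sup>2 - 2 Re (f v)\<close>; minimising sequences are
  Cauchy by the parallelogram law.\<close>

lemma Riesz:
  fixes f :: "'h::chilbert_space \<Rightarrow> complex"
  assumes add: "\<And>x y. f (x + y) = f x + f y"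
    and scale: "\<And>c x. f (c *\<^sub>C x) = c * f x"
    and bound: "\<And>x. cmod (f x) \<le> K * norm x"
  shows "\<exists>u. \<forall>v. f v = cinner u v"
proof -
  define J where "J v = (norm v)\<^sup>2 - 2 * Re (f v)" for v
  have bl: "bounded_linear f"
    by (rule bounded_linear_intro[where K = K])
      (use assms in \<open>auto simp: scaleR_scaleC scaleC_complex_def mult.commute\<close>)
  have scaleR: "f (r *\<^sub>R x) = r *\<^sub>R f x" for r x
    using bl by (rule linear_simps)
  \<comment> \<open>Completing the square in \<open>norm v\<close>.\<close>
  have Jlow: "- K\<^sup>2 \<le> J v" for v
  proof -
    have "Re (f v) \<le> K * norm v"
      using bound[of v] complex_Re_le_cmod[of "f v"] by linarith
    moreover have "0 \<le> (norm v - K)\<^sup>2" by simp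
    ultimately show ?thesis
      unfolding J_def power2_diff by (simp add: algebra_simps)
  qed
  define d where "d = (INF v. J v)"
  have bdd: "bdd_below (range J)"
    using Jlow by (auto simp: bdd_below_def)
  have d_le: "d \<le> J v" for v
    unfolding d_def by (rule cINF_lower[OF bdd]) simp
  have "\<exists>v. J v < d + 1 / real (Suc n)" for n
    using cINF_less_iff[of UNIV J "d + 1 / real (Suc n)"] bdd unfolding d_def by auto
  then obtain s where s: "\<And>n. J (s n) < d + 1 / real (Suc n)" by metis
  \<comment> \<open>In \<open>2 J v + 2 J w - 4 J ((v + w) / 2)\<close> the linear parts cancel, the
    parallelogram law leaves \<open>\<parallel>v - w\<parallel>^2\<close>, and the midpoint value is
    at least \<open>d\<close>.\<close>
  have par: "(norm (v - w))\<^sup>2 \<le> 2 * (J v - d) + 2 * (J w - d)" for v w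
  proof -
    have "(norm (v - w))\<^sup>2 = 2 * J v + 2 * J w - 4 * J ((1/2) *\<^sub>R (v + w))"
      unfolding J_def scaleR add norm_scaleR power_mult_distrib norm_add_square
      using norm_add_square[of v "- w"]
      by (simp add: cinner.minus_right power2_eq_square algebra_simps)
    moreover have "2 * (2 * d) \<le> 4 * J ((1/2) *\<^sub>R (v + w))"
      using d_le by simp
    ultimately show ?thesis by simp
  qed
  have "Cauchy s"
  proof (rule CauchyI)
    fix e :: real assume e: "0 < e"
    obtain N where N: "1 / real (Suc N) < e\<^sup>2 / 4"
      using nat_approx_posE[of "e\<^sup>2 / 4"] e by (metis divide_pos_pos zero_less_numeral zero_less_power)
    have le: "J (s n) - d < e\<^sup>2 / 4" if "n \<ge> N" for n
    proof -
      have "1 / real (Suc n) \<le> 1 / real (Suc N)"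
        using that by (simp add: frac_le)
      then show ?thesis using s[of n] N by linarith
    qed
    have "norm (s m - s n) < e" if "m \<ge> N" "n \<ge> N" for m n
    proof -
      have "(norm (s m - s n))\<^sup>2 < e\<^sup>2"
        using par[of "s m" "s n"] le[OF that(1)] le[OF that(2)] by simp
      then show ?thesis
        using e by (simp add: power2_less_imp_less)
    qed
    then show "\<exists>M. \<forall>m\<ge>M. \<forall>n\<ge>M. norm (s m - s n) < e" by blast
  qed
  then obtain u where u: "s \<longlonglongrightarrow> u"
    using Cauchy_convergent convergent_def by blast
  have "(\<lambda>n. J (s n)) \<longlonglongrightarrow> J u"
    unfolding J_def by (intro tendsto_intros u bounded_linear.tendsto[OF bl])
  moreover have "(\<lambda>n. d + 1 / real (Suc n)) \<longlonglongrightarrow> d + 0"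
    by (intro tendsto_intros LIMSEQ_Suc[OF lim_const_over_n])
  ultimately have "J u \<le> d"
    using LIMSEQ_le[of "\<lambda>n. J (s n)" "J u" "\<lambda>n. d + 1 / real (Suc n)" "d + 0"] s less_imp_le by auto
  then have min: "J u \<le> J v" for v
    using d_le[of v] by linarith
  \<comment> \<open>First variation: moving from the minimiser \<open>u\<close> by
    \<open>t w\<close> changes \<open>J\<close> by
    \<open>2 t b + t^2 \<parallel>w\<parallel>^2\<close>, which stays nonnegative for all
    \<open>t\<close> only if \<open>b = 0\<close>.\<close>
  have re: "Re (f w) = Re (cinner u w)" for w
  proof -
    define b where "b = Re (cinner u w) - Re (f w)"
    have q: "0 \<le> 2 * t * b + t\<^sup>2 * (norm w)\<^sup>2" for t
      using min[of "u + t *\<^sub>R w"] unfolding J_def norm_add_square add scaleR b_def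
      by (simp add: cinner.scaleR_right power_mult_distrib algebra_simps)
    have "b = 0"
    proof (cases "w = 0")
      case True
      then show ?thesis using bound[of 0] by (simp add: b_def cinner.zero_right)
    next
      case False
      then have p: "(norm w)\<^sup>2 > 0" by simp
      then have "2 * t * b + t\<^sup>2 * (norm w)\<^sup>2 = - b\<^sup>2 / (norm w)\<^sup>2" if "t = - b / (norm w)\<^sup>2" for t
        unfolding that by (simp add: power2_eq_square)
      with q[of "- b / (norm w)\<^sup>2"] have "b\<^sup>2 / (norm w)\<^sup>2 \<le> 0"
        by simp
      with p show ?thesis by (simp add: divide_le_0_iff)
    qed
    then show ?thesis by (simp add: b_def)
  qed
  have "f v = cinner u v" for v
  proof (rule complex_eqI)
    show "Re (f v) = Re (cinner u v)" by (rule re)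
    show "Im (f v) = Im (cinner u v)"
      using re[of "\<i> *\<^sub>C v"] by (simp add: scale cinner_scaleC_right)
  qed
  then show ?thesis by blast
qed

section \<open>Bounded operators\<close>

lemma BH_scaleC: "a \<in> BH \<Longrightarrow> blinfun_apply a (c *\<^sub>C v) = c *\<^sub>C blinfun_apply a v"
  by (simp add: BH_def)

text \<open>The value of \<open>b\<close> at \<open>v\<close> is the Riesz vector of
  \<open>f v\<close>. It depends linearly on \<open>v\<close> because \<open>f\<close> and the inner
  product are both conjugate-linear in the first argument.\<close>

lemma operator_of_form:
  fixes f :: "'h::chilbert_space \<Rightarrow> 'h \<Rightarrow> complex"
  assumes add: "\<And>x y z. f x (y + z) = f x y + f x z"
    and scale: "\<And>c x y. f x (c *\<^sub>C y) = c * f x y"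
    and addl: "\<And>x y z. f (x + y) z = f x z + f y z"
    and scalel: "\<And>c x y. f (c *\<^sub>C x) y = cnj c * f x y"
    and bound: "\<And>x y. cmod (f x y) \<le> K * norm x * norm y"
  shows "\<exists>b\<in>BH. \<forall>v w. f v w = cinner (blinfun_apply b v) w"
proof -
  have "\<exists>u. \<forall>w. f v w = cinner u w" for v
    by (rule Riesz[where K = "K * norm v"]) (use assms in auto)
  then obtain g where g: "\<And>v w. f v w = cinner (g v) w" by metis
  have eqI: "x = y" if "\<And>w. cinner x w = cinner y w" for x y :: 'h
    by (rule cinner_eqI) (metis that cinner_commute)
  have g_add: "g (x + y) = g x + g y" for x y
    by (rule eqI) (simp add: cinner_add_left g[symmetric] addl)
  have g_scale: "g (c *\<^sub>C x) = c *\<^sub>C g x" for c x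
    by (rule eqI) (simp add: cinner_scaleC_left g[symmetric] scalel)
  have g_bound: "norm (g x) \<le> norm x * K" for x
  proof (cases "g x = 0")
    case True
    \<comment> \<open>\<open>K\<close> carries no sign hypothesis; its sign is read off from
      \<open>bound\<close> at the pair \<open>x\<close>, \<open>x\<close>.\<close>
    have "0 \<le> K * norm x" if "x \<noteq> 0"
      using bound[of x x] that
      by (metis norm_ge_zero order_trans zero_le_mult_iff norm_le_zero_iff linorder_not_le mult_eq_0_iff)
    then show ?thesis using True by (cases "x = 0") (auto simp: mult.commute)
  next
    case False
    have "norm (g x) * norm (g x) \<le> K * norm x * norm (g x)"
      using bound[of x "g x"] by (simp add: g cinner_self power2_eq_square norm_mult)
    then show ?thesis using False by (simp add: mult.commute)
  qed
  have bl: "bounded_linear g"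
    by (rule bounded_linear_intro[where K = K])
      (use g_add g_scale g_bound in \<open>auto simp: scaleR_scaleC\<close>)
  have "Blinfun g \<in> BH"
    by (simp add: BH_def bounded_linear_Blinfun_apply[OF bl] g_scale)
  then show ?thesis
    by (intro bexI[of _ "Blinfun g"]) (simp_all add: bounded_linear_Blinfun_apply[OF bl] g)
qed

text \<open>\<open>adj\<close> is a definite description, so an adjoint is computed by exhibiting a
  candidate and checking the defining identity.\<close>

lemma adj_unique:
  assumes "b \<in> BH" "\<And>v w. cinner (blinfun_apply a v) w = cinner v (blinfun_apply b w)"
  shows "adj a = b"
  unfolding adj_def
proof (rule the_equality)
  fix b' assume b': "b' \<in> BH \<and> (\<forall>v w. cinner (blinfun_apply a v) w = cinner v (blinfun_apply b' w))"
  show "b' = b"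
    by (rule blinfun_eqI, rule cinner_eqI) (metis assms(2) b')
qed (use assms in auto)

text \<open>Existence behind the definite description: the form \<open>cinner x (a y)\<close> is
  bounded, and the operator representing it is the adjoint.\<close>

lemma adj_spec:
  assumes "a \<in> BH"
  shows adj_BH: "adj a \<in> BH"
    and cinner_adj_right: "cinner v (blinfun_apply (adj a) w) = cinner (blinfun_apply a v) w"
proof -
  have "\<exists>b\<in>BH. \<forall>v w. cinner v (blinfun_apply a w) = cinner (blinfun_apply b v) w"
  proof (rule operator_of_form[where K = "norm a"])
    fix x y
    have "cmod (cinner x (blinfun_apply a y)) \<le> norm x * norm (blinfun_apply a y)"
      by (rule cinner_Cauchy_Schwarz)
    also have "\<dots> \<le> norm x * (norm a * norm y)"
      by (intro mult_left_mono norm_blinfun) auto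
    finally show "cmod (cinner x (blinfun_apply a y)) \<le> norm a * norm x * norm y"
      by (simp add: mult_ac)
  qed (simp_all add: blinfun.add_right BH_scaleC[OF assms] cinner_add_right cinner_add_left
      cinner_scaleC_left cinner_scaleC_right)
  then obtain b where b: "b \<in> BH" "\<And>v w. cinner v (blinfun_apply a w) = cinner (blinfun_apply b v) w"
    by blast
  have b': "cinner (blinfun_apply a v) w = cinner v (blinfun_apply b w)" for v w
    by (metis b(2) cinner_commute)
  have "adj a = b"
    using b(1) b' by (rule adj_unique)
  then show "adj a \<in> BH" "cinner v (blinfun_apply (adj a) w) = cinner (blinfun_apply a v) w"
    using b(1) b' by simp_all
qed

lemma BH_closed [intro]:
  "(0 :: 'h \<Rightarrow>\<^sub>L 'h) \<in> BH" "(id_blinfun :: 'h \<Rightarrow>\<^sub>L 'h) \<in> BH"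
  "a \<in> BH \<Longrightarrow> b \<in> BH \<Longrightarrow> a + b \<in> BH"
  "a \<in> BH \<Longrightarrow> b \<in> BH \<Longrightarrow> a - b \<in> BH"
  "a \<in> BH \<Longrightarrow> b \<in> BH \<Longrightarrow> a o\<^sub>L b \<in> BH"
  for a b :: "'h::chilbert_space \<Rightarrow>\<^sub>L 'h"
proof -
  have 0: "c *\<^sub>C 0 = (0::'h)" for c
    using norm_scaleC[of c "0::'h"] by simp
  have d: "c *\<^sub>C x - c *\<^sub>C y = c *\<^sub>C (x - y)" for c and x y :: 'h
    using scaleC_add_right[of c "x - y" y] by simp
  show "0 \<in> (BH :: ('h \<Rightarrow>\<^sub>L 'h) set)" by (simp add: BH_def 0)
  show "id_blinfun \<in> (BH :: ('h \<Rightarrow>\<^sub>L 'h) set)" by (simp add: BH_def)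
  show "a \<in> BH \<Longrightarrow> b \<in> BH \<Longrightarrow> a + b \<in> BH"
    by (simp add: BH_def blinfun.add_left scaleC_add_right)
  show "a \<in> BH \<Longrightarrow> b \<in> BH \<Longrightarrow> a - b \<in> BH"
    by (simp add: BH_def blinfun.diff_left d)
  show "a \<in> BH \<Longrightarrow> b \<in> BH \<Longrightarrow> a o\<^sub>L b \<in> BH"
    by (simp add: BH_def)
qed

lemma adj_0: "adj 0 = (0 :: 'h::chilbert_space \<Rightarrow>\<^sub>L 'h)"
  by (rule adj_unique) (auto simp: cinner.zero_left cinner.zero_right)

lemma adj_id: "adj id_blinfun = (id_blinfun :: 'h::chilbert_space \<Rightarrow>\<^sub>L 'h)"
  by (rule adj_unique) auto

lemma adj_compose: "a \<in> BH \<Longrightarrow> b \<in> BH \<Longrightarrow> adj (a o\<^sub>L b) = adj b o\<^sub>L adj a"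
  by (rule adj_unique) (auto simp: cinner_adj_right adj_BH)

lemma norm_adj_le:
  assumes "a \<in> BH"
  shows "norm (adj a) \<le> norm a"
proof (rule norm_blinfun_bound)
  fix v
  let ?w = "blinfun_apply (adj a) v"
  have "(norm ?w)\<^sup>2 = cmod (cinner ?w ?w)"
    by (simp add: cinner_self norm_power)
  also have "\<dots> = cmod (cinner (blinfun_apply a ?w) v)"
    by (simp add: cinner_adj_right assms)
  also have "\<dots> \<le> norm (blinfun_apply a ?w) * norm v"
    by (rule cinner_Cauchy_Schwarz)
  also have "\<dots> \<le> (norm a * norm ?w) * norm v"
    by (intro mult_right_mono norm_blinfun) auto
  finally have "norm ?w * norm ?w \<le> norm ?w * (norm a * norm v)"
    by (simp add: power2_eq_square mult_ac)
  then show "norm ?w \<le> norm a * norm v"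
    by (cases "?w = 0") auto
qed auto

lemma norm_le_of_form:
  assumes "0 \<le> K" "\<And>v w. cmod (cinner v (blinfun_apply a w)) \<le> K * norm v * norm w"
  shows "norm a \<le> K"
proof (rule norm_blinfun_bound)
  fix w
  have "norm (blinfun_apply a w) * norm (blinfun_apply a w) \<le> norm (blinfun_apply a w) * (K * norm w)"
    using assms(2)[of "blinfun_apply a w" w]
    by (simp add: cinner_self power2_eq_square norm_mult mult_ac)
  then show "norm (blinfun_apply a w) \<le> K * norm w"
    using assms(1) by (cases "blinfun_apply a w = 0") auto
qed (rule assms(1))

section \<open>Rank one operators\<close>

definition rank_one :: "'h::chilbert_space \<Rightarrow> 'h \<Rightarrow> 'h \<Rightarrow>\<^sub>L 'h"
  where "rank_one x w = Blinfun (\<lambda>v. cinner x v *\<^sub>C w)"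

lemma rank_one_apply: "blinfun_apply (rank_one x w) v = cinner x v *\<^sub>C w"
proof -
  have "bounded_linear (\<lambda>v. cinner x v *\<^sub>C w)"
  proof (rule bounded_linear_intro[where K = "norm x * norm w"])
    fix v
    show "norm (cinner x v *\<^sub>C w) \<le> norm v * (norm x * norm w)"
      using mult_right_mono[OF cinner_Cauchy_Schwarz[of x v], of "norm w"]
      by (simp add: norm_scaleC mult_ac)
  qed (simp_all add: cinner_add_right scaleC_add_left cinner.scaleR_right scaleR_scaleC
      scaleC_scaleC cinner_scaleC_right)
  then show ?thesis by (simp add: rank_one_def bounded_linear_Blinfun_apply)
qed

lemma rank_one_BH: "rank_one x w \<in> BH"
  by (simp add: BH_def rank_one_apply cinner_scaleC_right scaleC_scaleC)

text \<open>Moving one fixed unit vector to a prescribed vector serves twice: to normalise the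
  vectors of the humps, and to build the sequences that define the \<tau>-seminorms.\<close>

lemma rank_one_self: "norm x = 1 \<Longrightarrow> blinfun_apply (rank_one x w) x = w"
  by (simp add: rank_one_apply cinner_self scaleC_one)

lemma norm_rank_one_le: "norm (rank_one x w) \<le> norm x * norm w"
proof (rule norm_blinfun_bound)
  fix v
  show "norm (blinfun_apply (rank_one x w) v) \<le> norm x * norm w * norm v"
    using mult_right_mono[OF cinner_Cauchy_Schwarz[of x v], of "norm w"]
    by (simp add: rank_one_apply norm_scaleC mult_ac)
qed simp

section \<open>Vector states\<close>

definition vector_state :: "'h::chilbert_space \<Rightarrow> ('h \<Rightarrow>\<^sub>L 'h) \<Rightarrow> complex"
  where "vector_state v a = cinner v (blinfun_apply a v)"

text \<open>Under a vector state the scalars in a \<tau>-seminorm become inner products in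
  \<open>H\<close>.\<close>

lemma vector_state_adj_compose:
  "b \<in> BH \<Longrightarrow> vector_state v (adj b o\<^sub>L a) = cinner (blinfun_apply b v) (blinfun_apply a v)"
  by (simp add: vector_state_def cinner_adj_right)

lemma is_state_vector_state:
  assumes "norm v = 1"
  shows "is_state (vector_state v)"
  using assms unfolding is_state_def vector_state_def op_pos_def
  by (simp add: blinfun.add_left cinner.add_right cinner_scaleC_right cinner_self)

lemma BH_sa_symmetric:
  assumes "a \<in> BH_sa"
  shows "cinner (blinfun_apply a v) w = cinner v (blinfun_apply a w)"
  using assms cinner_adj_right[of a v w] by (simp add: BH_sa_def)

lemma BH_saI:
  assumes "a \<in> BH" "\<And>v w. cinner (blinfun_apply a v) w = cinner v (blinfun_apply a w)"
  shows "a \<in> BH_sa"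
  using assms adj_unique[of a a] by (simp add: BH_sa_def)

lemma Im_cinner_BH_sa: "a \<in> BH_sa \<Longrightarrow> Im (cinner v (blinfun_apply a v)) = 0"
  using BH_sa_symmetric[of a v v] cinner_commute[of "blinfun_apply a v" v]
  by (simp add: complex_eq_iff)

text \<open>Quadratic forms of self-adjoint operators are real, so comparing real parts decides the
  order.\<close>

lemma op_le_iff:
  assumes "a \<in> BH_sa" "b \<in> BH_sa"
  shows "op_le a b \<longleftrightarrow>
    (\<forall>v. Re (cinner v (blinfun_apply a v)) \<le> Re (cinner v (blinfun_apply b v)))"
proof -
  have "b - a \<in> BH" using assms by (auto simp: BH_sa_def)
  then show ?thesis
    using assms by (simp add: op_le_def op_pos_def blinfun.diff_left cinner.diff_right Im_cinner_BH_sa)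
qed

text \<open>The signs of the terms with \<open>\<i>\<close> fit linearity in the second argument.
  The right side is written with real parts because limits along a directed set will arise as
  suprema of reals.\<close>

lemma polarization:
  assumes "a \<in> BH_sa"
  shows "cinner v (blinfun_apply a w) =
    (complex_of_real (Re (cinner (v + w) (blinfun_apply a (v + w))))
      - complex_of_real (Re (cinner (v - w) (blinfun_apply a (v - w))))
      - \<i> * complex_of_real (Re (cinner (v + \<i> *\<^sub>C w) (blinfun_apply a (v + \<i> *\<^sub>C w))))
      + \<i> * complex_of_real (Re (cinner (v - \<i> *\<^sub>C w) (blinfun_apply a (v - \<i> *\<^sub>C w))))) / 4"
proof -
  have BH: "a \<in> BH" using assms by (simp add: BH_sa_def)
  have re: "complex_of_real (Re (cinner u (blinfun_apply a u))) = cinner u (blinfun_apply a u)" for u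
    using Im_cinner_BH_sa[OF assms, of u] by (simp add: complex_eq_iff)
  show ?thesis
    unfolding re
    by (simp add: blinfun.add_right blinfun.diff_right BH_scaleC[OF BH] cinner.add_left
        cinner.add_right cinner.diff_left cinner.diff_right cinner_scaleC_left cinner_scaleC_right
        algebra_simps)
qed

text \<open>Vigier's theorem: the net \<open>\<langle>v, a w\<rangle>\<close> converges by polarization, and its limit is the form
  of a self-adjoint operator, which is an upper bound of the directed set.\<close>

lemma directed_limit_operator:
  fixes D :: "('h::chilbert_space \<Rightarrow>\<^sub>L 'h) set"
  assumes sa: "D \<subseteq> BH_sa" and dir: "op_directed D" and s: "s \<in> BH_sa"
    and ub: "\<And>a. a \<in> D \<Longrightarrow> op_le a s"
  shows "\<exists>b\<in>BH_sa. \<forall>v. Re (cinner v (blinfun_apply b v)) = (SUP a\<in>D. Re (cinner v (blinfun_apply a v)))"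
proof -
  define q where "q a v = Re (cinner v (blinfun_apply a v))" for a and v :: 'h
  \<comment> \<open>The filter generated by the tails of \<open>D\<close>; convergence along it is
    convergence of the net.\<close>
  define F where "F = (INF a\<in>D. principal {c\<in>D. op_le a c})"
  have ne: "D \<noteq> {}" using dir by (simp add: op_directed_def)
  have le_q: "op_le a c \<longleftrightarrow> (\<forall>v. q a v \<le> q c v)" if "a \<in> BH_sa" "c \<in> BH_sa" for a c
    using op_le_iff[OF that] by (simp add: q_def)
  have trans: "op_le a e" if "op_le a c" "op_le c e" "a \<in> D" "c \<in> D" "e \<in> D" for a c e
    using that sa by (meson le_q order_trans subsetD)
  have refl: "op_le a a" if "a \<in> D" for a
    using that sa le_q by blast
  have ev: "eventually P F \<longleftrightarrow> (\<exists>a\<in>D. \<forall>c\<in>D. op_le a c \<longrightarrow> P c)" for P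
  proof -
    have "eventually P F \<longleftrightarrow> (\<exists>a\<in>D. eventually P (principal {c\<in>D. op_le a c}))"
      unfolding F_def
    proof (rule eventually_INF_base[OF ne])
      fix a b assume "a \<in> D" "b \<in> D"
      then obtain c where c: "c \<in> D" "op_le a c" "op_le b c"
        using dir by (auto simp: op_directed_def)
      then show "\<exists>x\<in>D. principal {c \<in> D. op_le x c} \<le>
          inf (principal {c \<in> D. op_le a c}) (principal {c \<in> D. op_le b c})"
        using \<open>a \<in> D\<close> \<open>b \<in> D\<close> by (intro bexI[of _ c]) (auto intro: trans)
    qed
    then show ?thesis by (auto simp: eventually_principal)
  qed
  have nb: "F \<noteq> bot"
    using ev[of "\<lambda>_. False"] ne refl by (auto simp: trivial_limit_def)
  have evD: "eventually (\<lambda>a. a \<in> D) F"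
    using ev ne by auto
  have bdd: "bdd_above ((\<lambda>a. q a v) ` D)" for v
    using ub le_q sa s by (intro bdd_aboveI2[of _ _ "q s v"]) blast
  have limq: "((\<lambda>a. q a v) \<longlongrightarrow> (SUP a\<in>D. q a v)) F" for v
  proof (rule order_tendstoI)
    fix y assume "y < (SUP a\<in>D. q a v)"
    then obtain a where "a \<in> D" "y < q a v"
      using less_cSUP_iff[OF ne bdd] by blast
    then show "eventually (\<lambda>a. y < q a v) F"
      unfolding ev using le_q sa by (intro bexI[of _ a]) (auto intro: less_le_trans)
  next
    fix y assume y: "(SUP a\<in>D. q a v) < y"
    show "eventually (\<lambda>a. q a v < y) F"
      using evD by eventually_elim (rule le_less_trans[OF cSUP_upper[OF _ bdd] y])
  qed
  define f where "f v w = Lim F (\<lambda>a. cinner v (blinfun_apply a w))" for v w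
  have f: "((\<lambda>a. cinner v (blinfun_apply a w)) \<longlongrightarrow> f v w) F" for v w
  proof -
    let ?p = "\<lambda>a. (complex_of_real (q a (v + w)) - complex_of_real (q a (v - w))
        - \<i> * complex_of_real (q a (v + \<i> *\<^sub>C w)) + \<i> * complex_of_real (q a (v - \<i> *\<^sub>C w))) / 4"
    have t: "((\<lambda>a. complex_of_real (q a u)) \<longlongrightarrow> complex_of_real (SUP a\<in>D. q a u)) F" for u
      by (intro tendsto_of_real limq)
    have "\<exists>l. (?p \<longlongrightarrow> l) F"
      by (rule exI, rule tendsto_divide[OF tendsto_add[OF tendsto_diff[OF tendsto_diff[OF t t]
            tendsto_mult_left[OF t]] tendsto_mult_left[OF t]] tendsto_const]) simp
    then obtain l where l: "(?p \<longlongrightarrow> l) F" by blast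
    have "eventually (\<lambda>a. ?p a = cinner v (blinfun_apply a w)) F"
      using evD unfolding q_def
      by eventually_elim (rule polarization[symmetric], use sa in blast)
    with l have "((\<lambda>a. cinner v (blinfun_apply a w)) \<longlongrightarrow> l) F"
      by (rule Lim_transform_eventually)
    then show ?thesis
      unfolding f_def using tendsto_Lim[OF nb] by blast
  qed
  have f_eqI: "f v w = l" if "((\<lambda>a. cinner v (blinfun_apply a w)) \<longlongrightarrow> l) F" for v w l
    using tendsto_unique[OF nb f that] .
  obtain a0 where a0: "a0 \<in> D" using ne by blast
  \<comment> \<open>Elements of \<open>D\<close> need not have a common norm bound, but those above
    \<open>a0\<close> satisfy \<open>0 \<le> c - a0 \<le> s - a0\<close>, and such a tail determines
    the limit.\<close>
  define K where "K = norm (s - a0) + norm a0"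
  have bound: "cmod (cinner v (blinfun_apply c w)) \<le> K * norm v * norm w"
    if c: "c \<in> D" "op_le a0 c" for c v w
  proof -
    have csa: "c \<in> BH_sa" "a0 \<in> BH_sa" "c \<in> BH" "a0 \<in> BH"
      using c a0 sa by (auto simp: BH_sa_def)
    have dle: "Re (cinner u (blinfun_apply (c - a0) u)) \<le> norm (s - a0) * (norm u)\<^sup>2" for u
    proof -
      have "q c u \<le> q s u" using ub[OF c(1)] le_q csa s by blast
      then have "Re (cinner u (blinfun_apply (c - a0) u)) \<le> Re (cinner u (blinfun_apply (s - a0) u))"
        by (simp add: q_def blinfun.diff_left cinner.diff_right)
      also have "\<dots> \<le> cmod (cinner u (blinfun_apply (s - a0) u))"
        by (rule complex_Re_le_cmod)
      also have "\<dots> \<le> norm u * norm (blinfun_apply (s - a0) u)"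
        by (rule cinner_Cauchy_Schwarz)
      also have "\<dots> \<le> norm u * (norm (s - a0) * norm u)"
        by (intro mult_left_mono norm_blinfun) auto
      finally show ?thesis by (simp add: power2_eq_square mult_ac)
    qed
    have dpos: "0 \<le> Re (cinner u (blinfun_apply (c - a0) u))" for u
      using c(2) le_q csa by (simp add: q_def blinfun.diff_left cinner.diff_right)
    \<comment> \<open>Cauchy-Schwarz for the positive form of \<open>c - a0\<close> upgrades the
      bound on its diagonal to a bound on all its values.\<close>
    have "(cmod (cinner v (blinfun_apply (c - a0) w)))\<^sup>2 \<le>
        Re (cinner v (blinfun_apply (c - a0) v)) * Re (cinner w (blinfun_apply (c - a0) w))"
    proof (rule form_Cauchy_Schwarz[OF _ _ _ dpos])
      show "cinner y (blinfun_apply (c - a0) x) = cnj (cinner x (blinfun_apply (c - a0) y))" for x y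
        by (simp add: cinner_commute[symmetric] blinfun.diff_left cinner.diff_left cinner.diff_right
            BH_sa_symmetric csa)
      have "c - a0 \<in> BH" using csa by blast
      then show "cinner x (blinfun_apply (c - a0) (k *\<^sub>C y)) = k * cinner x (blinfun_apply (c - a0) y)" for x y k
        by (simp only: BH_scaleC cinner_scaleC_right)
    qed (simp add: blinfun.add_right cinner.add_right)
    also have "\<dots> \<le> (norm (s - a0) * (norm v)\<^sup>2) * (norm (s - a0) * (norm w)\<^sup>2)"
      by (intro mult_mono dle dpos) auto
    also have "\<dots> = (norm (s - a0) * norm v * norm w)\<^sup>2"
      by (simp add: power2_eq_square mult_ac)
    finally have 1: "cmod (cinner v (blinfun_apply (c - a0) w)) \<le> norm (s - a0) * norm v * norm w"
      by (rule power2_le_imp_le) simp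
    have "cmod (cinner v (blinfun_apply a0 w)) \<le> norm v * norm (blinfun_apply a0 w)"
      by (rule cinner_Cauchy_Schwarz)
    also have "\<dots> \<le> norm v * (norm a0 * norm w)"
      by (intro mult_left_mono norm_blinfun) auto
    finally have 2: "cmod (cinner v (blinfun_apply a0 w)) \<le> norm a0 * norm v * norm w"
      by (simp add: mult_ac)
    have "cinner v (blinfun_apply c w) = cinner v (blinfun_apply (c - a0) w) + cinner v (blinfun_apply a0 w)"
      by (simp add: blinfun.diff_left cinner.diff_right)
    then have "cmod (cinner v (blinfun_apply c w)) \<le>
        cmod (cinner v (blinfun_apply (c - a0) w)) + cmod (cinner v (blinfun_apply a0 w))"
      by (simp only: norm_triangle_ineq)
    with 1 2 show ?thesis
      by (simp add: K_def algebra_simps)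
  qed
  have f_bound: "cmod (f v w) \<le> K * norm v * norm w" for v w
  proof (rule Lim_norm_ubound[OF nb f])
    show "\<forall>\<^sub>F c in F. cmod (cinner v (blinfun_apply c w)) \<le> K * norm v * norm w"
      unfolding ev using a0 bound by blast
  qed
  have "\<exists>b\<in>BH. \<forall>v w. f v w = cinner (blinfun_apply b v) w"
  proof (rule operator_of_form[OF _ _ _ _ f_bound])
    fix x y z c
    show "f x (y + z) = f x y + f x z"
      by (rule f_eqI) (simp add: blinfun.add_right cinner.add_right tendsto_add f)
    show "f (x + y) z = f x z + f y z"
      by (rule f_eqI) (simp add: cinner.add_left tendsto_add f)
    show "f (c *\<^sub>C x) y = cnj c * f x y"
      by (rule f_eqI) (simp add: cinner_scaleC_left tendsto_mult_left f)
    \<comment> \<open>Operators outside \<open>D\<close> may be merely real-linear, so here the nets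
      are compared only eventually.\<close>
    show "f x (c *\<^sub>C y) = c * f x y"
    proof (rule f_eqI, rule Lim_transform_eventually)
      show "((\<lambda>a. c * cinner x (blinfun_apply a y)) \<longlongrightarrow> c * f x y) F"
        by (intro tendsto_mult_left f)
      show "\<forall>\<^sub>F a in F. c * cinner x (blinfun_apply a y) = cinner x (blinfun_apply a (c *\<^sub>C y))"
        using evD by eventually_elim (use sa in \<open>auto simp: BH_sa_def BH_scaleC cinner_scaleC_right\<close>)
    qed
  qed
  then obtain b where b: "b \<in> BH" "\<And>v w. f v w = cinner (blinfun_apply b v) w" by blast
  have herm: "f w v = cnj (f v w)" for v w
  proof (rule f_eqI, rule Lim_transform_eventually)
    show "((\<lambda>a. cnj (cinner v (blinfun_apply a w))) \<longlongrightarrow> cnj (f v w)) F"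
      by (intro tendsto_cnj f)
    show "\<forall>\<^sub>F a in F. cnj (cinner v (blinfun_apply a w)) = cinner w (blinfun_apply a v)"
      using evD
      by eventually_elim (use sa in \<open>auto simp: cinner_commute[symmetric] BH_sa_symmetric\<close>)
  qed
  have b': "cinner v (blinfun_apply b w) = f v w" for v w
    using b(2)[of w v] herm[of v w] cinner_commute[of v "blinfun_apply b w"] by simp
  have "b \<in> BH_sa"
    using b b' by (intro BH_saI) auto
  moreover have "Re (cinner v (blinfun_apply b v)) = (SUP a\<in>D. q a v)" for v
    unfolding b' using tendsto_unique[OF nb tendsto_Re[OF f] limq[unfolded q_def]]
    by (simp add: q_def)
  ultimately show ?thesis
    unfolding q_def by blast
qed

text \<open>Vigier's theorem yields an upper bound \<open>b\<close> of \<open>D\<close> whose form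
  is the pointwise supremum. The least upper bound \<open>s\<close> lies below \<open>b\<close>,
  which gives \<open>\<le>\<close>; the other inequality holds because \<open>s\<close> is an upper
  bound.\<close>

lemma normal_vector_state:
  fixes v :: "'h::chilbert_space"
  assumes "norm v = 1"
  shows "normal_state (vector_state v)"
  unfolding normal_state_def
proof (intro conjI allI impI)
  show "is_state (vector_state v)" by (rule is_state_vector_state) fact
  fix D :: "('h \<Rightarrow>\<^sub>L 'h) set" and s
  assume *: "D \<subseteq> BH_sa \<and> op_directed D \<and> op_is_lub D s"
  then have sa: "D \<subseteq> BH_sa" and dir: "op_directed D" and s: "s \<in> BH_sa"
    and ub: "\<And>a. a \<in> D \<Longrightarrow> op_le a s"
    and least: "\<And>b. b \<in> BH_sa \<Longrightarrow> (\<And>a. a \<in> D \<Longrightarrow> op_le a b) \<Longrightarrow> op_le s b"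
    by (auto simp: op_is_lub_def)
  have ne: "D \<noteq> {}" using dir by (simp add: op_directed_def)
  have s_ub: "Re (cinner w (blinfun_apply a w)) \<le> Re (cinner w (blinfun_apply s w))" if "a \<in> D" for a w
    using ub[OF that] sa that s op_le_iff by blast
  have bdd: "bdd_above ((\<lambda>a. Re (cinner w (blinfun_apply a w))) ` D)" for w
    by (rule bdd_aboveI2) (rule s_ub)
  obtain b where b: "b \<in> BH_sa"
      "\<And>w. Re (cinner w (blinfun_apply b w)) = (SUP a\<in>D. Re (cinner w (blinfun_apply a w)))"
    using directed_limit_operator[OF sa dir s ub] by blast
  have "op_le a b" if "a \<in> D" for a
    using that sa b cSUP_upper[OF that bdd] by (subst op_le_iff) auto
  then have "op_le s b" using least b(1) by blast
  then have "Re (cinner v (blinfun_apply s v)) \<le> (SUP a\<in>D. Re (cinner v (blinfun_apply a v)))"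
    using op_le_iff[OF s b(1)] b(2) by simp
  moreover have "(SUP a\<in>D. Re (cinner v (blinfun_apply a v))) \<le> Re (cinner v (blinfun_apply s v))"
    by (rule cSUP_least[OF ne s_ub])
  ultimately show "Re (vector_state v s) = (SUP a\<in>D. Re (vector_state v a))"
    by (simp add: vector_state_def)
qed

section \<open>The standard Hilbert module\<close>

text \<open>\<open>A\<close> and \<open>B\<close> bound the column operators
  \<open>v \<mapsto> (x\<^sub>j v)\<^sub>j\<close> and
  \<open>v \<mapsto> (y\<^sub>j v)\<^sub>j\<close>. Cauchy-Schwarz is used twice: in
  \<open>H\<close> for each \<open>j\<close>, then for the sum over \<open>j\<close>.\<close>

lemma norm_sum_adj_le:
  fixes x y :: "'i \<Rightarrow> 'h::chilbert_space \<Rightarrow>\<^sub>L 'h"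
  assumes x: "\<And>j. j \<in> F \<Longrightarrow> x j \<in> BH"
    and A: "0 \<le> A" "\<And>v. (\<Sum>j\<in>F. (norm (blinfun_apply (x j) v))\<^sup>2) \<le> A\<^sup>2 * (norm v)\<^sup>2"
    and B: "0 \<le> B" "\<And>v. (\<Sum>j\<in>F. (norm (blinfun_apply (y j) v))\<^sup>2) \<le> B\<^sup>2 * (norm v)\<^sup>2"
  shows "norm (\<Sum>j\<in>F. adj (x j) o\<^sub>L y j) \<le> A * B"
proof (rule norm_le_of_form)
  fix v w
  have "cmod (cinner v (blinfun_apply (\<Sum>j\<in>F. adj (x j) o\<^sub>L y j) w))
      = cmod (\<Sum>j\<in>F. cinner (blinfun_apply (x j) v) (blinfun_apply (y j) w))"
    by (simp add: blinfun.sum_left cinner.sum_right cinner_adj_right x)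
  also have "\<dots> \<le> (\<Sum>j\<in>F. \<bar>norm (blinfun_apply (x j) v)\<bar> * \<bar>norm (blinfun_apply (y j) w)\<bar>)"
    by (rule sum_norm_le) (simp add: cinner_Cauchy_Schwarz)
  also have "\<dots> \<le> L2_set (\<lambda>j. norm (blinfun_apply (x j) v)) F * L2_set (\<lambda>j. norm (blinfun_apply (y j) w)) F"
    by (rule L2_set_mult_ineq)
  also have "\<dots> \<le> (A * norm v) * (B * norm w)"
    using A B unfolding L2_set_def
    by (intro mult_mono real_le_lsqrt) (auto simp: power_mult_distrib sum_nonneg)
  finally show "cmod (cinner v (blinfun_apply (\<Sum>j\<in>F. adj (x j) o\<^sub>L y j) w)) \<le> A * B * norm v * norm w"
    by (simp add: mult_ac)
qed (use A B in simp)

text \<open>The left side is the quadratic form of the operator sum, evaluated at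
  \<open>v\<close>.\<close>

lemma sum_norm_square_le:
  assumes "\<And>j. j \<in> F \<Longrightarrow> x j \<in> BH"
  shows "(\<Sum>j\<in>F. (norm (blinfun_apply (x j) v))\<^sup>2) \<le> norm (\<Sum>j\<in>F. adj (x j) o\<^sub>L x j) * (norm v)\<^sup>2"
proof -
  let ?s = "\<Sum>j\<in>F. adj (x j) o\<^sub>L x j"
  have "(\<Sum>j\<in>F. (norm (blinfun_apply (x j) v))\<^sup>2) = Re (cinner v (blinfun_apply ?s v))"
    by (simp add: blinfun.sum_left cinner.sum_right cinner_adj_right assms cinner_self)
  also have "\<dots> \<le> cmod (cinner v (blinfun_apply ?s v))"
    by (rule complex_Re_le_cmod)
  also have "\<dots> \<le> norm v * norm (blinfun_apply ?s v)"
    by (rule cinner_Cauchy_Schwarz)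
  also have "\<dots> \<le> norm v * (norm ?s * norm v)"
    by (intro mult_left_mono norm_blinfun) auto
  finally show ?thesis by (simp add: power2_eq_square mult_ac)
qed

lemma l2A_BH: "x \<in> l2A \<Longrightarrow> x j \<in> BH"
  by (simp add: l2A_def)

lemma l2A_summable: "x \<in> l2A \<Longrightarrow> summable (\<lambda>j. adj (x j) o\<^sub>L x j)"
  by (simp add: l2A_def)

lemma l2A_summable_norm:
  assumes "x \<in> l2A"
  shows "summable (\<lambda>j. (norm (blinfun_apply (x j) v))\<^sup>2)"
proof -
  have "summable (\<lambda>j. Re (cinner v (blinfun_apply (adj (x j) o\<^sub>L x j) v)))"
    by (intro bounded_linear.summable[OF bounded_linear_Re]
        bounded_linear.summable[OF cinner.bounded_linear_right]
        bounded_linear.summable[OF blinfun.bounded_linear_left] l2A_summable assms)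
  then show ?thesis
    by (simp add: cinner_adj_right l2A_BH assms cinner_self)
qed

text \<open>Blocks of the mixed series are controlled by the same blocks of the two diagonal series,
  so the Cauchy criterion carries over.\<close>

lemma summable_hinner:
  fixes x y :: "nat \<Rightarrow> 'h::chilbert_space \<Rightarrow>\<^sub>L 'h"
  assumes x: "x \<in> l2A" and y: "y \<in> l2A"
  shows "summable (\<lambda>j. adj (x j) o\<^sub>L y j)"
  unfolding summable_Cauchy
proof (intro allI impI)
  fix e :: real assume e: "0 < e"
  obtain N1 where N1: "\<And>m n. m \<ge> N1 \<Longrightarrow> norm (\<Sum>j\<in>{m..<n}. adj (x j) o\<^sub>L x j) < e / 2"
    using l2A_summable[OF x] e unfolding summable_Cauchy by (meson half_gt_zero)
  obtain N2 where N2: "\<And>m n. m \<ge> N2 \<Longrightarrow> norm (\<Sum>j\<in>{m..<n}. adj (y j) o\<^sub>L y j) < e / 2"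
    using l2A_summable[OF y] e unfolding summable_Cauchy by (meson half_gt_zero)
  have "norm (\<Sum>j\<in>{m..<n}. adj (x j) o\<^sub>L y j) < e" if "m \<ge> max N1 N2" for m n
  proof -
    have "norm (\<Sum>j\<in>{m..<n}. adj (x j) o\<^sub>L y j) \<le> sqrt (e / 2) * sqrt (e / 2)"
    proof (rule norm_sum_adj_le)
      fix v :: 'h
      have "norm (\<Sum>j\<in>{m..<n}. adj (x j) o\<^sub>L x j) * (norm v)\<^sup>2 \<le> e / 2 * (norm v)\<^sup>2"
        using N1[of m n] that by (intro mult_right_mono) auto
      then show "(\<Sum>j\<in>{m..<n}. (norm (blinfun_apply (x j) v))\<^sup>2) \<le> (sqrt (e / 2))\<^sup>2 * (norm v)\<^sup>2"
        using sum_norm_square_le[of "{m..<n}" x v] l2A_BH[OF x] e by simp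
      have "norm (\<Sum>j\<in>{m..<n}. adj (y j) o\<^sub>L y j) * (norm v)\<^sup>2 \<le> e / 2 * (norm v)\<^sup>2"
        using N2[of m n] that by (intro mult_right_mono) auto
      then show "(\<Sum>j\<in>{m..<n}. (norm (blinfun_apply (y j) v))\<^sup>2) \<le> (sqrt (e / 2))\<^sup>2 * (norm v)\<^sup>2"
        using sum_norm_square_le[of "{m..<n}" y v] l2A_BH[OF y] e by simp
    qed (use e l2A_BH[OF x] in auto)
    then show ?thesis using e by simp
  qed
  then show "\<exists>N. \<forall>m\<ge>N. \<forall>n. norm (\<Sum>j\<in>{m..<n}. adj (x j) o\<^sub>L y j) < e" by blast
qed

text \<open>Complex linearity has to survive norm limits, since module inner products are infinite
  sums.\<close>

lemma closed_BH: "closed (BH :: ('h::chilbert_space \<Rightarrow>\<^sub>L 'h) set)"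
proof -
  have bl: "bounded_linear (\<lambda>v::'h. c *\<^sub>C v)" for c
    using blinfun.bounded_linear_right[of "op_scaleC c (id_blinfun :: 'h \<Rightarrow>\<^sub>L 'h)"] by simp
  have "closed {a :: 'h \<Rightarrow>\<^sub>L 'h. blinfun_apply a (c *\<^sub>C v) = c *\<^sub>C blinfun_apply a v}" for c v
    by (intro closed_Collect_eq continuous_intros bounded_linear.continuous_on[OF bl])
  then have "closed (\<Inter>c. \<Inter>v. {a :: 'h \<Rightarrow>\<^sub>L 'h. blinfun_apply a (c *\<^sub>C v) = c *\<^sub>C blinfun_apply a v})"
    by (intro closed_INT ballI)
  moreover have "BH = (\<Inter>c. \<Inter>v. {a :: 'h \<Rightarrow>\<^sub>L 'h. blinfun_apply a (c *\<^sub>C v) = c *\<^sub>C blinfun_apply a v})"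
    by (auto simp: BH_def)
  ultimately show ?thesis by simp
qed

lemma hinner_BH:
  assumes "x \<in> l2A" "y \<in> l2A"
  shows "hinner x y \<in> BH"
proof (rule closed_sequentially[OF closed_BH])
  show "(\<lambda>n. \<Sum>j<n. adj (x j) o\<^sub>L y j) \<longlonglongrightarrow> hinner x y"
    unfolding hinner_def using summable_LIMSEQ[OF summable_hinner[OF assms]] .
  fix n
  have "adj (x j) o\<^sub>L y j \<in> BH" for j
    using assms by (intro BH_closed adj_BH l2A_BH)
  then show "(\<Sum>j<n. adj (x j) o\<^sub>L y j) \<in> BH"
    by (induction n) auto
qed

lemma cinner_hinner:
  assumes "x \<in> l2A" "y \<in> l2A"
  shows "(\<lambda>j. cinner (blinfun_apply (x j) v) (blinfun_apply (y j) w)) sums cinner v (blinfun_apply (hinner x y) w)"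
proof -
  have "(\<lambda>j. adj (x j) o\<^sub>L y j) sums hinner x y"
    unfolding hinner_def using summable_hinner[OF assms] by (rule summable_sums)
  then have "(\<lambda>j. cinner v (blinfun_apply (adj (x j) o\<^sub>L y j) w)) sums cinner v (blinfun_apply (hinner x y) w)"
    by (intro bounded_linear.sums[OF cinner.bounded_linear_right]
        bounded_linear.sums[OF blinfun.bounded_linear_left])
  then show ?thesis
    by (simp add: cinner_adj_right l2A_BH assms)
qed

lemma adj_hinner:
  assumes "x \<in> l2A" "y \<in> l2A"
  shows "adj (hinner x y) = hinner y x"
proof (rule adj_unique)
  show "hinner y x \<in> BH" by (rule hinner_BH) fact+
  fix v w
  have "(\<lambda>j. cnj (cinner (blinfun_apply (x j) w) (blinfun_apply (y j) v)))
      sums cnj (cinner w (blinfun_apply (hinner x y) v))"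
    using cinner_hinner[OF assms, of w v] by (rule sums_cnj[THEN iffD2])
  then have "(\<lambda>j. cinner (blinfun_apply (y j) v) (blinfun_apply (x j) w))
      sums cinner (blinfun_apply (hinner x y) v) w"
    by (simp flip: cinner_commute)
  then show "cinner (blinfun_apply (hinner x y) v) w = cinner v (blinfun_apply (hinner y x) w)"
    using cinner_hinner[OF assms(2,1), of v w] by (rule sums_unique2)
qed

section \<open>Unit sequences and right multiplication\<close>

definition unit_seq :: "nat \<Rightarrow> nat \<Rightarrow> 'h::chilbert_space \<Rightarrow>\<^sub>L 'h"
  where "unit_seq i j = (if j = i then id_blinfun else 0)"

lemma unit_seq_l2A: "unit_seq i \<in> l2A"
proof -
  have "summable (\<lambda>j. adj (unit_seq i j) o\<^sub>L (unit_seq i j :: 'a \<Rightarrow>\<^sub>L 'a))"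
    by (rule summable_finite[of "{i}"]) (auto simp: unit_seq_def)
  then show ?thesis by (auto simp: l2A_def unit_seq_def)
qed

lemma hinner_unit_seq: "hinner (unit_seq i) x = x i"
proof -
  have "hinner (unit_seq i) x = (\<Sum>j\<in>{i}. adj (unit_seq i j) o\<^sub>L x j)"
    unfolding hinner_def by (rule suminf_finite) (auto simp: unit_seq_def adj_0)
  then show ?thesis
    by (simp add: unit_seq_def adj_id blinfun_eqI)
qed

text \<open>Both parts follow from \<open>\<langle>x a, x a\<rangle> = a\<^sup>* \<langle>x,
  x\<rangle> a\<close>, which holds term by term and passes to the sum by continuity.\<close>

lemma right_mult_l2A:
  assumes x: "x \<in> l2A" and a: "a \<in> BH"
  shows "(\<lambda>j. x j o\<^sub>L a) \<in> l2A" and "hnorm (\<lambda>j. x j o\<^sub>L a) \<le> norm a * hnorm x"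
proof -
  have eq: "adj (x j o\<^sub>L a) o\<^sub>L (x j o\<^sub>L a) = adj a o\<^sub>L ((adj (x j) o\<^sub>L x j) o\<^sub>L a)" for j
    by (rule blinfun_eqI) (simp add: adj_compose a l2A_BH[OF x])
  have bl: "bounded_linear (\<lambda>b. adj a o\<^sub>L (b o\<^sub>L a))"
    by (intro bounded_linear_compose[OF bounded_bilinear.bounded_linear_right[OF bounded_bilinear_blinfun_compose]]
        bounded_bilinear.bounded_linear_left[OF bounded_bilinear_blinfun_compose])
  have "(\<lambda>j. adj (x j o\<^sub>L a) o\<^sub>L (x j o\<^sub>L a)) sums (adj a o\<^sub>L (hinner x x o\<^sub>L a))"
    unfolding eq hinner_def by (intro bounded_linear.sums[OF bl] summable_sums l2A_summable x)
  then have s: "summable (\<lambda>j. adj (x j o\<^sub>L a) o\<^sub>L (x j o\<^sub>L a))"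
    and h: "hinner (\<lambda>j. x j o\<^sub>L a) (\<lambda>j. x j o\<^sub>L a) = adj a o\<^sub>L (hinner x x o\<^sub>L a)"
    unfolding hinner_def by (auto simp: sums_iff)
  show "(\<lambda>j. x j o\<^sub>L a) \<in> l2A"
    using s a l2A_BH[OF x] by (auto simp: l2A_def)
  have "norm (adj a o\<^sub>L (hinner x x o\<^sub>L a)) \<le> norm (adj a) * norm (hinner x x o\<^sub>L a)"
    by (rule norm_blinfun_compose)
  also have "\<dots> \<le> norm a * (norm (hinner x x) * norm a)"
    by (intro mult_mono norm_adj_le a norm_blinfun_compose) auto
  finally have "sqrt (norm (adj a o\<^sub>L (hinner x x o\<^sub>L a))) \<le> sqrt ((norm a)\<^sup>2 * norm (hinner x x))"
    by (simp add: power2_eq_square mult_ac)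
  then show "hnorm (\<lambda>j. x j o\<^sub>L a) \<le> norm a * hnorm x"
    unfolding hnorm_def h by (simp add: real_sqrt_mult)
qed

text \<open>This passes from an operator norm to one unit vector: if no block and unit vector
  exceeded \<open>d\<^sup>2\<close>, all finite sections of the inner product of the tail with
  itself would have norm at most \<open>d\<^sup>2\<close>, and so would their limit.\<close>

lemma tail_block:
  fixes x :: "nat \<Rightarrow> 'h::chilbert_space \<Rightarrow>\<^sub>L 'h"
  assumes x: "x \<in> l2A" and d: "0 < d" and tail: "d < hnorm (\<lambda>j. if j < n then 0 else x j)"
  shows "\<exists>m>n. \<exists>v. norm v = 1 \<and> d\<^sup>2 < (\<Sum>j=n..<m. (norm (blinfun_apply (x j) v))\<^sup>2)"
proof (rule ccontr)
  assume contr: "\<not> ?thesis"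
  define z where "z = (\<lambda>j. if j < n then 0 else x j)"
  have z: "adj (z j) o\<^sub>L z j = (if j < n then 0 else adj (x j) o\<^sub>L x j)" for j
    by (simp add: z_def adj_0)
  have "summable (\<lambda>j. adj (z j) o\<^sub>L z j) \<longleftrightarrow> summable (\<lambda>j. adj (x j) o\<^sub>L x j)"
    unfolding z by (rule summable_cong) (auto simp: eventually_sequentially intro: exI[of _ n])
  then have s: "(\<lambda>m. \<Sum>j<m. adj (z j) o\<^sub>L z j) \<longlonglongrightarrow> hinner z z"
    unfolding hinner_def using l2A_summable[OF x] by (intro summable_LIMSEQ) simp
  have small: "(\<Sum>j=n..<m. (norm (blinfun_apply (x j) v))\<^sup>2) \<le> d\<^sup>2 * (norm v)\<^sup>2" if "m > n" for m v
  proof (cases "v = 0")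
    case False
    define u where "u = (1 / norm v) *\<^sub>R v"
    have "norm u = 1" using False by (simp add: u_def)
    with contr that have "(\<Sum>j=n..<m. (norm (blinfun_apply (x j) u))\<^sup>2) \<le> d\<^sup>2"
      using not_less by blast
    moreover have "(\<Sum>j=n..<m. (norm (blinfun_apply (x j) u))\<^sup>2)
        = (\<Sum>j=n..<m. (norm (blinfun_apply (x j) v))\<^sup>2) / (norm v)\<^sup>2"
      by (simp add: u_def blinfun.scaleR_right power_divide sum_divide_distrib)
    ultimately show ?thesis using False by (simp add: field_simps)
  qed simp
  have "norm (\<Sum>j<m. adj (z j) o\<^sub>L z j) \<le> d * d" if "m > n" for m
  proof -
    have "(\<Sum>j<m. adj (z j) o\<^sub>L z j) = (\<Sum>j=n..<m. adj (x j) o\<^sub>L x j)"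
      unfolding z by (rule sum.mono_neutral_cong_right) auto
    also have "norm \<dots> \<le> d * d"
      by (rule norm_sum_adj_le) (use small[OF that] d l2A_BH[OF x] in auto)
    finally show ?thesis .
  qed
  then have "norm (hinner z z) \<le> d * d"
    by (intro Lim_bounded[OF tendsto_norm[OF s], of "Suc n"]) auto
  then have "hnorm z \<le> sqrt (d * d)"
    unfolding hnorm_def by (rule real_sqrt_le_mono)
  with d tail show False by (simp add: z_def)
qed

section \<open>The gliding hump\<close>

text \<open>\<open>suminf\<close> of a divergent series has no meaningful value; summability is what
  lets finite blocks be estimated by a seminorm.\<close>

lemma tau_summable:
  assumes w: "\<And>j. norm (w j) = 1" and x: "x \<in> l2A"
  shows "summable (\<lambda>j. (cmod (cinner (w j) (blinfun_apply (x j) v)))\<^sup>2)"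
proof (rule summable_comparison_test'[OF l2A_summable_norm[OF x, of v]])
  fix j
  have "cmod (cinner (w j) (blinfun_apply (x j) v)) \<le> norm (blinfun_apply (x j) v)"
    using cinner_Cauchy_Schwarz[of "w j" "blinfun_apply (x j) v"] w by simp
  then show "norm ((cmod (cinner (w j) (blinfun_apply (x j) v)))\<^sup>2) \<le> (norm (blinfun_apply (x j) v))\<^sup>2"
    by (simp add: power_mono)
qed

text \<open>Used to split a hump into its distance from a centre and the contribution of that
  centre.\<close>

lemma norm_diff_square_ge:
  fixes a b :: "'a::real_normed_vector"
  shows "(norm b)\<^sup>2 \<le> 2 * (norm (a - b))\<^sup>2 + 2 * (norm a)\<^sup>2"
proof -
  have "norm b \<le> norm (a - b) + norm a"
    using norm_triangle_ineq4[of a "a - b"] by simp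
  then have "(norm b)\<^sup>2 \<le> (norm (a - b) + norm a)\<^sup>2"
    by (rule power_mono) simp
  also have "\<dots> \<le> 2 * (norm (a - b))\<^sup>2 + 2 * (norm a)\<^sup>2"
    using sum_squares_bound[of "norm (a - b)" "norm a"] by (simp add: power2_sum)
  finally show ?thesis .
qed

text \<open>Every \<open>\<phi> (y\<^sub>j\<^sup>* y\<^sub>j)\<close> equals
  \<open>\<parallel>w\<^sub>j\<parallel>\<^sup>2 = 1\<close>, and hence so does the
  supremum.\<close>

lemma tau_admissible_vector_state:
  assumes "norm v = 1" "\<And>j. norm (w j) = 1"
  shows "tau_admissible (vector_state v) (\<lambda>j. rank_one v (w j))"
  using assms unfolding tau_admissible_def
  by (auto simp: normal_vector_state rank_one_BH vector_state_adj_compose rank_one_self cinner_self)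

lemma tau_seminorm_vector_state:
  assumes "norm v = 1"
  shows "tau_seminorm (vector_state v) (\<lambda>j. rank_one v (w j)) x =
    sqrt (\<Sum>j. (cmod (cinner (w j) (blinfun_apply (x j) v)))\<^sup>2)"
  unfolding tau_seminorm_def
  by (simp add: rank_one_BH vector_state_adj_compose rank_one_self assms)

lemma gliding_hump_not_totally_bounded:
  fixes u :: "nat \<Rightarrow> nat \<Rightarrow> 'h::chilbert_space \<Rightarrow>\<^sub>L 'h"
  assumes u: "\<And>k. u k \<in> l2A" and g: "strict_mono g" and d: "0 < d" and xi: "norm \<xi> = 1"
    and hump: "\<And>k. d\<^sup>2 < (\<Sum>j=g k..<g (Suc k). (norm (blinfun_apply (u k j) \<xi>))\<^sup>2)"
  shows "\<not> tau_totally_bounded (range u)"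
proof
  assume tb: "tau_totally_bounded (range u)"
  \<comment> \<open>The index of the block containing \<open>j\<close>; indices below
    \<open>g 0\<close> get the value 0.\<close>
  define k where "k j = (LEAST k. j < g (Suc k))" for j
  have k_eq: "k j = i" if "g i \<le> j" "j < g (Suc i)" for i j
    unfolding k_def
  proof (rule Least_equality)
    fix l assume "j < g (Suc l)"
    with that(1) have "g i < g (Suc l)" by simp
    then show "i \<le> l" using g by (simp add: strict_mono_less)
  qed (rule that(2))
  \<comment> \<open>Pairing with the direction of the hump recovers its full norm. Where the hump
    vanishes, the default \<open>\<xi>\<close> keeps \<open>w j\<close> a unit vector.\<close>
  define w where "w j = (let z = blinfun_apply (u (k j) j) \<xi> in
    if z = 0 then \<xi> else (1 / norm z) *\<^sub>R z)" for j
  have w: "norm (w j) = 1" for j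
    by (simp add: w_def Let_def xi)
  have w_cinner: "cmod (cinner (w j) (blinfun_apply (u i j) \<xi>)) = norm (blinfun_apply (u i j) \<xi>)"
    if "g i \<le> j" "j < g (Suc i)" for i j
    using k_eq[OF that]
    by (auto simp: w_def Let_def cinner.zero_right cinner.scaleR_left cinner_self power2_eq_square
        norm_mult norm_divide)
  \<comment> \<open>The radius fits the final estimate
    \<open>2 * (d / 2)^2 + 2 * (d^2 / 4) = d^2\<close>.\<close>
  have "tau_admissible (vector_state \<xi>) (\<lambda>j. rank_one \<xi> (w j)) \<and> 0 < d / 2"
    using tau_admissible_vector_state[of \<xi> w, OF xi w] d by simp
  then have "\<exists>C. finite C \<and> C \<subseteq> l2A \<and> (\<forall>x\<in>range u. \<exists>c\<in>C.
      tau_seminorm (vector_state \<xi>) (\<lambda>j. rank_one \<xi> (w j)) (\<lambda>j. c j - x j) < d / 2)"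
    by (rule tb[unfolded tau_totally_bounded_def, rule_format])
  then obtain C where C: "finite C" "C \<subseteq> l2A" and
    cover: "\<And>x. x \<in> range u \<Longrightarrow> \<exists>c\<in>C.
      tau_seminorm (vector_state \<xi>) (\<lambda>j. rank_one \<xi> (w j)) (\<lambda>j. c j - x j) < d / 2"
    by blast
  define p where "p x j = (cmod (cinner (w j) (blinfun_apply (x j) \<xi>)))\<^sup>2"
    for x :: "nat \<Rightarrow> 'h \<Rightarrow>\<^sub>L 'h" and j
  have p_summable: "summable (p x)" if "x \<in> l2A" for x
    using tau_summable[OF w that] unfolding p_def .
  have p_diff: "p x j \<le> 2 * p (\<lambda>j. y j - x j) j + 2 * p y j" for x y j
    using norm_diff_square_ge[of "cinner (w j) (blinfun_apply (x j) \<xi>)" "cinner (w j) (blinfun_apply (y j) \<xi>)"]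
    by (simp add: p_def blinfun.diff_left cinner.diff_right)
  have "\<forall>c\<in>C. eventually (\<lambda>n. \<forall>m. norm (sum (p c) {n..<m}) < d\<^sup>2 / 4) sequentially"
  proof
    fix c assume "c \<in> C"
    then have "summable (p c)" using C p_summable by blast
    then show "eventually (\<lambda>n. \<forall>m. norm (sum (p c) {n..<m}) < d\<^sup>2 / 4) sequentially"
      unfolding summable_Cauchy eventually_sequentially using d
      by (elim allE[of _ "d\<^sup>2 / 4"] impE) simp_all
  qed
  then have "eventually (\<lambda>n. \<forall>c\<in>C. \<forall>m. norm (sum (p c) {n..<m}) < d\<^sup>2 / 4) sequentially"
    by (rule eventually_ball_finite[OF C(1)])
  then obtain N where N: "\<And>n c m. n \<ge> N \<Longrightarrow> c \<in> C \<Longrightarrow> norm (sum (p c) {n..<m}) < d\<^sup>2 / 4"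
    unfolding eventually_sequentially by meson
  \<comment> \<open>The bound \<open>N\<close> also selects the hump: \<open>u N\<close> is large on
    a block starting at \<open>g N \<ge> N\<close>, where every centre is already small.\<close>
  obtain c where c: "c \<in> C"
    and cu: "tau_seminorm (vector_state \<xi>) (\<lambda>j. rank_one \<xi> (w j)) (\<lambda>j. c j - u N j) < d / 2"
    using cover[of "u N"] by blast
  let ?B = "{g N..<g (Suc N)}"
  \<comment> \<open>Without this the bound on the seminorm of the difference would say nothing about
    its blocks.\<close>
  have "summable (p (\<lambda>j. c j - u N j))"
  proof (rule summable_comparison_test')
    show "summable (\<lambda>j. 2 * p (u N) j + 2 * p c j)"
      using c C u by (intro summable_add summable_mult p_summable) auto
    fix j
    show "norm (p (\<lambda>j. c j - u N j) j) \<le> 2 * p (u N) j + 2 * p c j"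
      using norm_diff_square_ge[of "cinner (w j) (blinfun_apply (c j - u N j) \<xi>)" "cinner (w j) (blinfun_apply (c j) \<xi>)"]
      by (simp add: p_def blinfun.diff_left cinner.diff_right)
  qed
  then have "sum (p (\<lambda>j. c j - u N j)) ?B \<le> (\<Sum>j. p (\<lambda>j. c j - u N j) j)"
    by (rule sum_le_suminf) (auto simp: p_def)
  also have "\<dots> < (d / 2)\<^sup>2"
    using cu d real_less_rsqrt real_sqrt_less_iff[of _ "(d / 2)\<^sup>2"]
    unfolding tau_seminorm_vector_state[OF xi] p_def by simp
  finally have "sum (p (\<lambda>j. c j - u N j)) ?B < d\<^sup>2 / 4"
    by (simp add: power_divide)
  moreover have "sum (p c) ?B < d\<^sup>2 / 4"
    using N[OF _ c, of "g N" "g (Suc N)"] strict_mono_imp_increasing[OF g, of N] by simp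
  moreover have "sum (p (u N)) ?B \<le> 2 * sum (p (\<lambda>j. c j - u N j)) ?B + 2 * sum (p c) ?B"
    unfolding sum_distrib_left sum.distrib[symmetric] by (rule sum_mono) (rule p_diff)
  moreover have "sum (p (u N)) ?B = (\<Sum>j\<in>?B. (norm (blinfun_apply (u N j) \<xi>))\<^sup>2)"
    by (rule sum.cong) (auto simp: p_def w_cinner)
  ultimately show False
    using hump[of N] by simp
qed

section \<open>Truncations and approximation in norm\<close>

lemma truncation_Theta_span:
  assumes S: "\<And>y. y \<in> l2A \<Longrightarrow> S y \<in> l2A"
    and adjoint: "\<And>x y. x \<in> l2A \<Longrightarrow> y \<in> l2A \<Longrightarrow> hinner (T x) y = hinner x (S y)"
    and T: "\<And>x. x \<in> l2A \<Longrightarrow> T x \<in> l2A"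
  shows "\<exists>F\<in>Theta_span. \<forall>x\<in>l2A. \<forall>j. F x j = (if j < n then T x j else 0)"
proof -
  define F where "F = (\<lambda>x j. \<Sum>i<n. op_scaleC 1 (Theta (S (unit_seq i)) (unit_seq i) x j))"
  have "F \<in> Theta_span"
    unfolding Theta_span_def F_def mem_Collect_eq
    by (intro exI[of _ n] exI[of _ "\<lambda>_. 1"] exI[of _ "\<lambda>i. S (unit_seq i)"] exI[of _ unit_seq])
      (simp add: S unit_seq_l2A)
  moreover have "F x j = (if j < n then T x j else 0)" if x: "x \<in> l2A" for x j
  proof -
    \<comment> \<open>The chain is \<open>\<langle>S e\<^sub>i, x\<rangle> = \<langle>x, S
      e\<^sub>i\<rangle>\<^sup>* = \<langle>T x, e\<^sub>i\<rangle>\<^sup>* = \<langle>e\<^sub>i, T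
      x\<rangle>\<close>.\<close>
    have "hinner (S (unit_seq i)) x = T x i" for i
    proof -
      have "hinner (S (unit_seq i)) x = adj (hinner x (S (unit_seq i)))"
        by (simp add: adj_hinner x S unit_seq_l2A)
      also have "\<dots> = hinner (unit_seq i) (T x)"
        using adjoint[OF x unit_seq_l2A[of i]] adj_hinner[OF T[OF x] unit_seq_l2A[of i]] by simp
      finally show ?thesis by (simp add: hinner_unit_seq)
    qed
    then have "F x j = (\<Sum>i<n. if i = j then T x j else 0)"
      unfolding F_def Theta_def
      by (intro sum.cong refl blinfun_eqI) (simp add: unit_seq_def scaleC_one)
    then show ?thesis by simp
  qed
  ultimately show ?thesis by blast
qed

theorem theorem4p7:
  fixes T :: "'h::chilbert_space l2_op"
  assumes "compact_op T"
  shows "T \<in> opnorm_closure Theta_span"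
proof -
  have Ba: "T \<in> Ba" and cpt: "\<And>S. hbounded S \<Longrightarrow> tau_totally_bounded (T ` S)"
    using assms by (auto simp: compact_op_def)
  have T: "\<And>x. x \<in> l2A \<Longrightarrow> T x \<in> l2A"
    and T_mult: "\<And>x a. x \<in> l2A \<Longrightarrow> a \<in> BH \<Longrightarrow> T (\<lambda>j. x j o\<^sub>L a) = (\<lambda>j. T x j o\<^sub>L a)"
    using Ba by (auto simp: Ba_def A_linear_def)
  obtain S where S: "\<And>y. y \<in> l2A \<Longrightarrow> S y \<in> l2A"
      "\<And>x y. x \<in> l2A \<Longrightarrow> y \<in> l2A \<Longrightarrow> hinner (T x) y = hinner x (S y)"
    using Ba unfolding Ba_def by blast
  define tail where "tail n x = hnorm (\<lambda>j. if j < n then 0 else T x j)" for n x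
  \<comment> \<open>Uniform decay of the tails over the unit ball; total boundedness enters
    here.\<close>
  have small: "\<exists>n. \<forall>x\<in>l2A. hnorm x \<le> 1 \<longrightarrow> tail n x \<le> d" if d: "0 < d" for d
  proof (rule ccontr)
    assume "\<not> ?thesis"
    then have "\<exists>x. x \<in> l2A \<and> hnorm x \<le> 1 \<and> d < tail n x" for n
      by (meson not_le)
    then obtain x where x: "\<And>n. x n \<in> l2A" "\<And>n. hnorm (x n) \<le> 1" "\<And>n. d < tail n (x n)"
      by metis
    have "\<exists>m v. n < m \<and> norm v = 1 \<and> d\<^sup>2 < (\<Sum>j=n..<m. (norm (blinfun_apply (T (x n) j) v))\<^sup>2)" for n
      using tail_block[OF T[OF x(1)] d x(3)[unfolded tail_def]] by metis
    then obtain m v where m: "\<And>n. n < m n" and v: "\<And>n. norm (v n) = 1"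
      and hump: "\<And>n. d\<^sup>2 < (\<Sum>j=n..<m n. (norm (blinfun_apply (T (x n) j) (v n)))\<^sup>2)"
      by metis
    \<comment> \<open>\<open>m n\<close> ends the block starting at \<open>n\<close>, so iteration
      from 0 gives adjacent blocks, the \<open>k\<close>-th one belonging to
      \<open>x (g k)\<close>.\<close>
    define g where "g k = (m ^^ k) 0" for k
    have g_Suc: "g (Suc k) = m (g k)" for k by (simp add: g_def)
    have g: "strict_mono g" by (rule strict_monoI_Suc) (simp add: g_Suc m)
    \<comment> \<open>Any unit vector would do. The negated claim supplies one, so the zero space is
      covered as well.\<close>
    define \<xi> where "\<xi> = v 0"
    have xi: "norm \<xi> = 1" by (simp add: \<xi>_def v)
    \<comment> \<open>Right multiplication by \<open>a k\<close> keeps the unit ball invariant,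
      commutes with \<open>T\<close>, and replaces evaluation at \<open>v (g k)\<close> by
      evaluation at \<open>\<xi>\<close>.\<close>
    define a where "a k = rank_one \<xi> (v (g k))" for k
    define y where "y k = (\<lambda>j. x (g k) j o\<^sub>L a k)" for k
    have a: "a k \<in> BH" for k by (simp add: a_def rank_one_BH)
    have a_norm: "norm (a k) \<le> 1" for k
      using norm_rank_one_le[of \<xi> "v (g k)"] by (simp add: a_def xi v)
    have y: "y k \<in> l2A" for k
      unfolding y_def by (rule right_mult_l2A(1)[OF x(1) a])
    have "hnorm (y k) \<le> 1" for k
    proof -
      have "hnorm (y k) \<le> norm (a k) * hnorm (x (g k))"
        unfolding y_def by (rule right_mult_l2A(2)[OF x(1) a])
      also have "\<dots> \<le> 1 * 1"
        using a_norm x(2) by (intro mult_mono) (auto simp: hnorm_def)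
      finally show ?thesis by simp
    qed
    then have "hbounded (range y)"
      using y by (auto simp: hbounded_def)
    then have "tau_totally_bounded (range (\<lambda>k. T (y k)))"
      using cpt[of "range y"] by (simp add: image_image)
    moreover have "\<not> tau_totally_bounded (range (\<lambda>k. T (y k)))"
    proof (rule gliding_hump_not_totally_bounded[OF T[OF y] g d xi])
      fix k
      have "blinfun_apply (T (y k) j) \<xi> = blinfun_apply (T (x (g k)) j) (v (g k))" for j
        by (simp add: y_def T_mult x a) (simp add: a_def rank_one_self xi)
      then show "d\<^sup>2 < (\<Sum>j=g k..<g (Suc k). (norm (blinfun_apply (T (y k) j) \<xi>))\<^sup>2)"
        using hump[of "g k"] by (simp add: g_Suc)
    qed
    ultimately show False by contradiction
  qed
  have "\<exists>F\<in>Theta_span. opnorm (\<lambda>x j. T x j - F x j) < e" if e: "0 < e" for e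
  proof -
    \<comment> \<open>A supremum inherits only \<open>\<le>\<close>, so \<open>e / 2\<close> is
      taken to end with a strict inequality.\<close>
    obtain n where n: "\<And>x. x \<in> l2A \<Longrightarrow> hnorm x \<le> 1 \<Longrightarrow> tail n x \<le> e / 2"
      using small[of "e / 2"] e by auto
    obtain F where F: "F \<in> Theta_span" "\<And>x j. x \<in> l2A \<Longrightarrow> F x j = (if j < n then T x j else 0)"
      using truncation_Theta_span[of S T n] S T by blast
    have "opnorm (\<lambda>x j. T x j - F x j) \<le> e / 2"
      unfolding opnorm_def
    proof (rule cSUP_least)
      have "(\<lambda>_. 0) \<in> {x :: nat \<Rightarrow> 'h \<Rightarrow>\<^sub>L 'h. x \<in> l2A \<and> hnorm x \<le> 1}"
        by (auto simp: l2A_def hnorm_def hinner_def adj_0)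
      then show "{x :: nat \<Rightarrow> 'h \<Rightarrow>\<^sub>L 'h. x \<in> l2A \<and> hnorm x \<le> 1} \<noteq> {}" by blast
      fix x :: "nat \<Rightarrow> 'h \<Rightarrow>\<^sub>L 'h"
      assume "x \<in> {x. x \<in> l2A \<and> hnorm x \<le> 1}"
      moreover from this have "(\<lambda>j. T x j - F x j) = (\<lambda>j. if j < n then 0 else T x j)"
        by (auto simp: F(2))
      ultimately show "hnorm (\<lambda>j. T x j - F x j) \<le> e / 2"
        using n[of x] by (simp add: tail_def)
    qed
    then show ?thesis using F(1) e by (intro bexI[of _ F]) auto
  qed
  then show ?thesis
    using Ba by (auto simp: opnorm_closure_def)
qed

end
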